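(* Suppose that $(x_j,f_j)_{j=1}^\infty$ is a shrinking Schauder frame for a Banach space $X$ and that $W$ is an associated space of $(x_j,f_j)_{j=1}^\infty$ with a shrinking associated basis $(w_j)_{j=1}^\infty$. Then there exists an admissible sequence $(N_k)_{k=1}^\infty$ such that the basis $(z_j)_{j=1}^\infty$ of $Z_{(N_k)}$ is dominated by $(w_j)_{j=1}^\infty$.
   Context: Let $X$ be a separable infinite dimensional Banach space. A sequence of pairs $(x_i,f_i)_{i=1}^\infty$ in $X\times X^*$ with $x_i\neq 0$ for all $i$ is a Schauder frame for $X$ if $x=\sum_{i=1}^\infty f_i(x)x_i$ (norm convergence) for all $x\in X$. It is shrinking if $(f_i,x_i)_{i=1}^\infty$ is a Schauder frame for $X^*$, i.e. $f=\sum_{i=1}^\infty f(x_i)f_i$ in norm for all $f\in X^*$ (the nonvanishing convention is only for the $x_i$). For $m\leqslant n$, $P_{[m,n]}:X\to X$ is $P_{[m,n]}(x)=\sum_{i=m}^n f_i(x)x_i$. A Banach space $Z$ with a Schauder basis $(z_i)$ is an associated space for $(x_i,f_i)$, and $(z_i)$ is an associated basis, if the maps $T:X\to Z$, $T(x)=\sum_i f_i(x)z_i$, and $S:Z\to X$, $S(\sum_i a_iz_i)=\sum_i a_ix_i$, are well defined and bounded. A Schauder basis is shrinking if its biorthogonal functionals form a Schauder basis of the dual space. An increasing sequence of natural numbers $(N_k)_{k=1}^\infty$ is called admissible (for the shrinking frame $(x_i,f_i)$) if for every $k\in\mathbb{N}$ and all $x\in X$, $$\sup_{\substack{m_0<n_0\leqslant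 k\\ N_k\leqslant m\leqslant n}}\|P_{[m_0,n_0]}P_{[m,n]}x\|\leqslant 2^{-k}\|x\|.$$ For an admissible $(N_k)$, $Z_{(N_k)}$ is the completion of $c_{00}$ (finitely supported scalar sequences, with unit vector basis $(z_i)$) under the norm $$\Big\|\sum a_i z_i\Big\|_{(N_k)}=\max\Big\{\sup_{m\leqslant n}\Big\|\sum_{m\leqslant i\leqslant n}a_ix_i\Big\|,\ \sup_{k\in\mathbb{N}}\ \sup_{\substack{m_0\leqslant n_0\leqslant k\\ N_k\leqslant m\leqslant n}}2^k\Big\|P_{[m_0,n_0]}\sum_{m\leqslant i\leqslant n}a_ix_i\Big\|\Big\}.$$ (Suprema over empty index sets are $0$.) A basis $(w_i)$ dominates a basis $(z_i)$ if there is $K>0$ with $\|\sum a_iz_i\|\leqslant K\|\sum a_iw_i\|$ for all $(a_i)\in c_{00}$. *)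

theory Defs
  imports "HOL-Analysis.Analysis"
begin

text \<open>
  All Banach spaces are real. Sequences are indexed from 0: the pair written \<open>(x i, f i)\<close> here
  is the pair usually written with index \<open>i + 1\<close>. All other indices (the bounds of blocks, the
  parameter \<open>k\<close>, and the values \<open>N k\<close>, which are themselves bounds of blocks) are shifted by one
  in the same way, so the comparisons between them keep their usual form; only a weight
  usually written \<open>2 ^ k\<close> becomes \<open>2 ^ Suc k\<close>.
\<close>

definition schauder_basis :: "(nat \<Rightarrow> 'a::real_normed_vector) \<Rightarrow> bool" where
  "schauder_basis z \<longleftrightarrow> (\<forall>v. \<exists>!a::nat \<Rightarrow> real. (\<lambda>i. a i *\<^sub>R z i) sums v)"

text \<open>The functionals biorthogonal to a basis exist and are unique.\<close>

definition shrinking_basis :: "(nat \<Rightarrow> 'a::real_normed_vector) \<Rightarrow> bool" where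
  "shrinking_basis z \<longleftrightarrow> schauder_basis z \<and>
     (\<exists>g :: nat \<Rightarrow> 'a \<Rightarrow>\<^sub>L real.
        (\<forall>i j. blinfun_apply (g i) (z j) = (if i = j then 1 else 0)) \<and> schauder_basis g)"

definition schauder_frame ::
    "(nat \<Rightarrow> 'a::real_normed_vector) \<Rightarrow> (nat \<Rightarrow> 'a \<Rightarrow>\<^sub>L real) \<Rightarrow> bool" where
  "schauder_frame x f \<longleftrightarrow>
     (\<forall>i. x i \<noteq> 0) \<and> (\<forall>v. (\<lambda>i. blinfun_apply (f i) v *\<^sub>R x i) sums v)"

definition shrinking_frame ::
    "(nat \<Rightarrow> 'a::real_normed_vector) \<Rightarrow> (nat \<Rightarrow> 'a \<Rightarrow>\<^sub>L real) \<Rightarrow> bool" where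
  "shrinking_frame x f \<longleftrightarrow> schauder_frame x f \<and>
     (\<forall>g :: 'a \<Rightarrow>\<^sub>L real. (\<lambda>i. blinfun_apply g (x i) *\<^sub>R f i) sums g)"

text \<open>The witnesses \<open>T\<close> and \<open>S\<close> are the analysis and synthesis operators.\<close>

definition associated_basis ::
    "(nat \<Rightarrow> 'a::real_normed_vector) \<Rightarrow> (nat \<Rightarrow> 'a \<Rightarrow>\<^sub>L real) \<Rightarrow>
     (nat \<Rightarrow> 'b::real_normed_vector) \<Rightarrow> bool" where
  "associated_basis x f z \<longleftrightarrow> schauder_basis z \<and>
     (\<exists>T :: 'a \<Rightarrow>\<^sub>L 'b. \<forall>v. (\<lambda>i. blinfun_apply (f i) v *\<^sub>R z i) sums blinfun_apply T v) \<and>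
     (\<exists>S :: 'b \<Rightarrow>\<^sub>L 'a. \<forall>(a::nat \<Rightarrow> real) u.
        (\<lambda>i. a i *\<^sub>R z i) sums u \<longrightarrow> (\<lambda>i. a i *\<^sub>R x i) sums blinfun_apply S u)"

definition frame_proj ::
    "(nat \<Rightarrow> 'a::real_normed_vector) \<Rightarrow> (nat \<Rightarrow> 'a \<Rightarrow>\<^sub>L real) \<Rightarrow> nat \<Rightarrow> nat \<Rightarrow> 'a \<Rightarrow> 'a" where
  "frame_proj x f m n v = (\<Sum>i=m..n. blinfun_apply (f i) v *\<^sub>R x i)"

text \<open>Suprema are taken in \<^typ>\<open>ennreal\<close>, where the supremum of the empty set is \<open>0\<close>.\<close>

definition admissible ::
    "(nat \<Rightarrow> 'a::real_normed_vector) \<Rightarrow> (nat \<Rightarrow> 'a \<Rightarrow>\<^sub>L real) \<Rightarrow> (nat \<Rightarrow> nat) \<Rightarrow> bool" where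
  "admissible x f N \<longleftrightarrow> strict_mono N \<and>
     (\<forall>k v. (SUP (m0, n0, m, n) \<in> {(m0, n0, m, n). m0 < n0 \<and> n0 \<le> k \<and> N k \<le> m \<and> m \<le> n}.
               ennreal (norm (frame_proj x f m0 n0 (frame_proj x f m n v))))
            \<le> ennreal ((1/2) ^ Suc k * norm v))"

definition c00 :: "(nat \<Rightarrow> real) set" where
  "c00 = {a. finite {i. a i \<noteq> 0}}"

definition lin_comb :: "(nat \<Rightarrow> real) \<Rightarrow> (nat \<Rightarrow> 'a::real_vector) \<Rightarrow> 'a" where
  "lin_comb a z = (\<Sum>i | a i \<noteq> 0. a i *\<^sub>R z i)"

definition dominates ::
    "(nat \<Rightarrow> 'a::real_normed_vector) \<Rightarrow> (nat \<Rightarrow> 'b::real_normed_vector) \<Rightarrow> bool" where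
  "dominates w z \<longleftrightarrow> (\<exists>K>0. \<forall>a\<in>c00. norm (lin_comb a z) \<le> K * norm (lin_comb a w))"

definition Z_norm ::
    "(nat \<Rightarrow> 'a::real_normed_vector) \<Rightarrow> (nat \<Rightarrow> 'a \<Rightarrow>\<^sub>L real) \<Rightarrow> (nat \<Rightarrow> nat) \<Rightarrow> (nat \<Rightarrow> real) \<Rightarrow> ennreal"
  where
  "Z_norm x f N a = max
     (SUP (m, n) \<in> {(m, n). m \<le> n}. ennreal (norm (\<Sum>i=m..n. a i *\<^sub>R x i)))
     (SUP k. SUP (m0, n0, m, n) \<in> {(m0, n0, m, n). m0 \<le> n0 \<and> n0 \<le> k \<and> N k \<le> m \<and> m \<le> n}.
        ennreal (2 ^ Suc k * norm (frame_proj x f m0 n0 (\<Sum>i=m..n. a i *\<^sub>R x i))))"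

text \<open>
  The completion of \<open>c00\<close> under \<open>Z_norm x f N\<close> is realised inside a Banach space of bounded
  functions with the supremum norm: a sequence \<open>a\<close> is sent to the family of all vectors whose
  norms occur in \<open>Z_norm x f N a\<close>. The index \<open>(0, m0, n0, m, n)\<close> carries the vectors of the
  first supremum, the index \<open>(Suc k, m0, n0, m, n)\<close> those of the second one for \<open>k\<close>. This map is
  linear and isometric on \<open>c00\<close> (lemma \<open>norm_lin_comb_Z_basis\<close>), so the closure of its range,
  which is complete (lemma \<open>Z_space_banach\<close>), is the completion, and the images of the unit
  vectors are its canonical basis.
\<close>

type_synonym block_index = "nat \<times> nat \<times> nat \<times> nat \<times> nat"

definition Z_coords ::
    "(nat \<Rightarrow> 'a::real_normed_vector) \<Rightarrow> (nat \<Rightarrow> 'a \<Rightarrow>\<^sub>L real) \<Rightarrow> (nat \<Rightarrow> nat) \<Rightarrow> (nat \<Rightarrow> real) \<Rightarrow>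
     block_index \<Rightarrow> 'a" where
  "Z_coords x f N a = (\<lambda>(j, m0, n0, m, n).
     (case j of
        0 \<Rightarrow> (\<Sum>i=m..n. a i *\<^sub>R x i)
      | Suc k \<Rightarrow>
          if m0 \<le> n0 \<and> n0 \<le> k \<and> N k \<le> m \<and> m \<le> n
          then 2 ^ Suc k *\<^sub>R frame_proj x f m0 n0 (\<Sum>i=m..n. a i *\<^sub>R x i) else 0))"

definition Z_basis ::
    "(nat \<Rightarrow> 'a::real_normed_vector) \<Rightarrow> (nat \<Rightarrow> 'a \<Rightarrow>\<^sub>L real) \<Rightarrow> (nat \<Rightarrow> nat) \<Rightarrow>
     nat \<Rightarrow> (block_index \<Rightarrow>\<^sub>C 'a)" where
  "Z_basis x f N i = Bcontfun (Z_coords x f N (\<lambda>j. if j = i then 1 else 0))"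

definition Z_space ::
    "(nat \<Rightarrow> 'a::real_normed_vector) \<Rightarrow> (nat \<Rightarrow> 'a \<Rightarrow>\<^sub>L real) \<Rightarrow> (nat \<Rightarrow> nat) \<Rightarrow>
     (block_index \<Rightarrow>\<^sub>C 'a) set" where
  "Z_space x f N = closure ((\<lambda>a. lin_comb a (Z_basis x f N)) ` c00)"

lemma continuous_on_block_index: "continuous_on UNIV (g :: block_index \<Rightarrow> 'a::topological_space)"
proof -
  have "open A" for A :: "block_index set"
  proof (rule Topological_Spaces.openI)
    fix p assume "p \<in> A"
    obtain a b c d e where p: "p = (a, b, c, d, e)" by (cases p) auto
    have "open ({a} \<times> {b} \<times> {c} \<times> {d} \<times> {e})"
      by (intro open_Times open_discrete)
    moreover have "{a} \<times> {b} \<times> {c} \<times> {d} \<times> {e} = {p}" by (auto simp: p)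
    ultimately show "\<exists>T. open T \<and> p \<in> T \<and> T \<subseteq> A" using \<open>p \<in> A\<close> by (intro exI[of _ "{p}"]) simp
  qed
  then show ?thesis by (simp add: continuous_on_open_vimage)
qed

lemma frame_proj_sum:
  "frame_proj x f m n (\<Sum>i\<in>A. a i *\<^sub>R y i) = (\<Sum>i\<in>A. a i *\<^sub>R frame_proj x f m n (y i))"
  by (simp add: frame_proj_def blinfun.sum_right blinfun.scaleR_right scaleR_sum_left
      scaleR_sum_right) (rule sum.swap)

lemma Z_coords_unit_bcontfun:
  assumes "strict_mono N"
  shows "Z_coords x f N (\<lambda>j. if j = i then 1 else 0) \<in> bcontfun"
proof -
  let ?e = "\<lambda>j. if j = i then 1 else (0::real)"
  have blk: "(\<Sum>j=m..n. ?e j *\<^sub>R x j) = (if m \<le> i \<and> i \<le> n then x i else 0)" for m n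
    by (simp add: if_distrib[of "\<lambda>c. c *\<^sub>R _"] sum.delta cong: if_cong)
  have P0: "frame_proj x f m n 0 = 0" for m n by (simp add: frame_proj_def)
  define F where "F = {0, x i} \<union>
      (\<lambda>(k, m0, n0). 2 ^ Suc k *\<^sub>R frame_proj x f m0 n0 (x i)) ` ({..i} \<times> {..i} \<times> {..i})"
  have "finite F" by (simp add: F_def)
  have "Z_coords x f N ?e p \<in> F" for p
  proof -
    obtain j m0 n0 m n where p: "p = (j, m0, n0, m, n)" by (cases p) auto
    show ?thesis
    proof (cases j)
      case 0
      then show ?thesis by (simp add: p Z_coords_def blk F_def)
    next
      case (Suc k)
      show ?thesis
      proof (cases "m0 \<le> n0 \<and> n0 \<le> k \<and> N k \<le> m \<and> m \<le> n \<and> m \<le> i \<and> i \<le> n")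
        case True
        have "k \<le> N k" using assms by (rule strict_mono_imp_increasing)
        with True have *: "(k, m0, n0) \<in> {..i} \<times> {..i} \<times> {..i}" by auto
        have "Z_coords x f N ?e p = (\<lambda>(k, m0, n0). 2 ^ Suc k *\<^sub>R frame_proj x f m0 n0 (x i)) (k, m0, n0)"
          using True by (simp only: p Z_coords_def Suc blk) simp
        then show ?thesis unfolding F_def using * by blast
      next
        case False
        then have "Z_coords x f N ?e p = 0"
          by (auto simp only: p Z_coords_def Suc blk P0 prod.case nat.case if_False split: if_splits) simp_all
        then show ?thesis by (simp add: F_def)
      qed
    qed
  qed
  then have "range (Z_coords x f N ?e) \<subseteq> F" by auto
  then have "bounded (range (Z_coords x f N ?e))"
    using \<open>finite F\<close> finite_imp_bounded finite_subset by blast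
  then show ?thesis using continuous_on_block_index by (simp add: bcontfun_def)
qed

lemma apply_Z_basis:
  assumes "strict_mono N"
  shows "apply_bcontfun (Z_basis x f N i) = Z_coords x f N (\<lambda>j. if j = i then 1 else 0)"
  by (simp add: Z_basis_def Bcontfun_inverse Z_coords_unit_bcontfun[OF assms])

lemma apply_bcontfun_sum: "apply_bcontfun (\<Sum>i\<in>A. g i) p = (\<Sum>i\<in>A. apply_bcontfun (g i) p)"
  by (induction A rule: infinite_finite_induct) auto

lemma apply_lin_comb_Z_basis:
  assumes "strict_mono N" "a \<in> c00"
  shows "apply_bcontfun (lin_comb a (Z_basis x f N)) p = Z_coords x f N a p"
proof -
  let ?A = "{i. a i \<noteq> 0}"
  have fin: "finite ?A" using assms(2) by (simp add: c00_def)
  have blk: "(\<Sum>j=m..n. (if j = i then 1 else (0::real)) *\<^sub>R x j) = (if i \<in> {m..n} then x i else 0)" for i m n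
    by (simp add: if_distrib[of "\<lambda>c. c *\<^sub>R _"] sum.delta cong: if_cong)
  have sup: "(\<Sum>j=m..n. a j *\<^sub>R x j) = (\<Sum>i\<in>?A. a i *\<^sub>R (if i \<in> {m..n} then x i else 0))" for m n
  proof -
    have "(\<Sum>i\<in>?A. a i *\<^sub>R (if i \<in> {m..n} then x i else 0)) = (\<Sum>i\<in>?A. if i \<in> {m..n} then a i *\<^sub>R x i else 0)"
      by (intro sum.cong) auto
    also have "\<dots> = (\<Sum>i\<in>?A \<inter> {m..n}. a i *\<^sub>R x i)" by (rule sum.inter_restrict[OF fin, symmetric])
    also have "\<dots> = (\<Sum>j=m..n. a j *\<^sub>R x j)" by (rule sum.mono_neutral_left) auto
    finally show ?thesis by simp
  qed
  obtain j m0 n0 m n where p: "p = (j, m0, n0, m, n)" by (cases p) auto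
  have "apply_bcontfun (lin_comb a (Z_basis x f N)) p
      = (\<Sum>i\<in>?A. a i *\<^sub>R Z_coords x f N (\<lambda>j. if j = i then 1 else 0) p)"
    by (simp add: lin_comb_def apply_bcontfun_sum apply_Z_basis[OF assms(1)])
  also have "\<dots> = Z_coords x f N a p"
  proof (cases j)
    case 0
    then show ?thesis by (simp only: p Z_coords_def blk sup prod.case nat.case)
  next
    case (Suc k)
    show ?thesis
    proof (cases "m0 \<le> n0 \<and> n0 \<le> k \<and> N k \<le> m \<and> m \<le> n")
      case True
      then show ?thesis
        by (simp only: p Z_coords_def Suc blk sup prod.case nat.case if_True simp_thms frame_proj_sum
            scaleR_sum_right scaleR_left_commute)
    next
      case False
      then show ?thesis by (simp only: p Z_coords_def Suc prod.case nat.case if_False) simp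
    qed
  qed
  finally show ?thesis .
qed

lemma norm_lin_comb_Z_basis:
  assumes "strict_mono N" "a \<in> c00"
  shows "ennreal (norm (lin_comb a (Z_basis x f N))) = Z_norm x f N a"
proof (rule antisym)
  let ?u = "lin_comb a (Z_basis x f N)"
  have app: "norm (Z_coords x f N a p) \<le> norm ?u" for p
    using norm_bounded[of ?u p] by (simp add: apply_lin_comb_Z_basis[OF assms])
  show "Z_norm x f N a \<le> ennreal (norm ?u)"
    unfolding Z_norm_def
  proof (intro max.boundedI SUP_least; clarify)
    fix m n :: nat
    show "ennreal (norm (\<Sum>i=m..n. a i *\<^sub>R x i)) \<le> ennreal (norm ?u)"
      using app[of "(0, 0, 0, m, n)"] by (simp add: Z_coords_def ennreal_leI)
  next
    fix k m0 n0 m n :: nat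
    assume "m0 \<le> n0" "n0 \<le> k" "N k \<le> m" "m \<le> n"
    then show "ennreal (2 ^ Suc k * norm (frame_proj x f m0 n0 (\<Sum>i=m..n. a i *\<^sub>R x i))) \<le> ennreal (norm ?u)"
      using app[of "(Suc k, m0, n0, m, n)"] by (intro ennreal_leI) (simp add: Z_coords_def)
  qed
  then have fin: "Z_norm x f N a < top" using ennreal_less_top le_less_trans by blast
  have le: "ennreal (norm (Z_coords x f N a p)) \<le> Z_norm x f N a" for p
  proof -
    obtain j m0 n0 m n where p: "p = (j, m0, n0, m, n)" by (cases p) auto
    show ?thesis
    proof (cases j)
      case 0
      show ?thesis
      proof (cases "m \<le> n")
        case True
        then show ?thesis unfolding Z_norm_def
          by (intro max.coboundedI1 SUP_upper2[of "(m, n)"]) (auto simp: p 0 Z_coords_def)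
      qed (simp add: p 0 Z_coords_def)
    next
      case (Suc k)
      show ?thesis
      proof (cases "m0 \<le> n0 \<and> n0 \<le> k \<and> N k \<le> m \<and> m \<le> n")
        case True
        then show ?thesis unfolding Z_norm_def
          by (intro max.coboundedI2 SUP_upper2[of k] SUP_upper2[of "(m0, n0, m, n)"])
            (auto simp: p Suc Z_coords_def)
      next
        case False
        then show ?thesis by (auto simp: p Suc Z_coords_def)
      qed
    qed
  qed
  have "norm ?u \<le> enn2real (Z_norm x f N a)"
  proof (rule norm_bound)
    fix p
    have "enn2real (ennreal (norm (Z_coords x f N a p))) \<le> enn2real (Z_norm x f N a)"
      using le[of p] fin by (rule enn2real_mono)
    then show "norm (apply_bcontfun ?u p) \<le> enn2real (Z_norm x f N a)"
      by (simp add: apply_lin_comb_Z_basis[OF assms])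
  qed
  then show "ennreal (norm ?u) \<le> Z_norm x f N a"
    using fin by (metis ennreal_enn2real ennreal_leI)
qed

lemma range_lin_comb: "(\<lambda>a. lin_comb a z) ` c00 = span (range z)"
proof (rule set_eqI, rule iffI)
  fix u assume "u \<in> (\<lambda>a. lin_comb a z) ` c00"
  then show "u \<in> span (range z)"
    by (force simp only: lin_comb_def intro: span_sum span_scale span_base)
next
  fix u assume "u \<in> span (range z)"
  then show "u \<in> (\<lambda>a. lin_comb a z) ` c00"
  proof (induction rule: span_induct_alt)
    case base
    show ?case by (rule image_eqI[of _ _ "\<lambda>_. 0"]) (auto simp: lin_comb_def c00_def)
  next
    case (step c y v)
    then obtain a i where a: "a \<in> c00" "v = lin_comb a z" and y: "y = z i" by auto
    let ?b = "a(i := a i + c)"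
    let ?A = "insert i {j. a j \<noteq> 0}"
    have fin: "finite ?A" using a(1) by (simp add: c00_def)
    have "{j. ?b j \<noteq> 0} \<subseteq> ?A" by auto
    then have b: "?b \<in> c00" unfolding c00_def using fin finite_subset by blast
    have "lin_comb ?b z = (\<Sum>j\<in>?A. ?b j *\<^sub>R z j)"
      unfolding lin_comb_def by (rule sum.mono_neutral_left) (use fin in auto)
    also have "\<dots> = (\<Sum>j\<in>?A. (if j = i then c *\<^sub>R z i else 0) + a j *\<^sub>R z j)"
      by (rule sum.cong) (auto simp: scaleR_left_distrib)
    also have "\<dots> = c *\<^sub>R z i + (\<Sum>j\<in>?A. a j *\<^sub>R z j)"
      unfolding sum.distrib using fin by (subst sum.delta) auto
    also have "(\<Sum>j\<in>?A. a j *\<^sub>R z j) = lin_comb a z"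
      unfolding lin_comb_def by (rule sum.mono_neutral_right) (use fin in auto)
    finally show ?case using a b y by (metis image_eqI)
  qed
qed

lemma Cauchy_bcontfun_LIMSEQ:
  fixes u :: "nat \<Rightarrow> ('i::topological_space \<Rightarrow>\<^sub>C 'a::banach)"
  assumes "Cauchy u"
  obtains l where "u \<longlonglongrightarrow> l"
proof -
  have "\<exists>N. \<forall>m n p. N \<le> m \<and> N \<le> n \<and> True \<longrightarrow> dist (u m p) (u n p) < e" if "0 < e" for e :: real
    using assms that unfolding Cauchy_def by (meson dist_fun_lt_imp_dist_val_lt)
  then obtain g where "\<forall>e>0. \<exists>N. \<forall>n p. N \<le> n \<and> True \<longrightarrow> dist (u n p) (g p) < e"
    using uniformly_convergent_eq_cauchy[of "\<lambda>_. True" "\<lambda>n. apply_bcontfun (u n)"] by auto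
  then have "uniform_limit UNIV (\<lambda>n. apply_bcontfun (u n)) g sequentially"
    unfolding uniform_limit_sequentially_iff by blast
  from uniform_limit_bcontfunE[OF this sequentially_bot] that show thesis by metis
qed

lemma Z_space_banach:
  fixes x :: "nat \<Rightarrow> 'a::banach"
  shows "subspace (Z_space x f N)" "complete (Z_space x f N)"
proof -
  let ?S = "span (range (Z_basis x f N))"
  show "complete (Z_space x f N)"
  proof (rule completeI)
    fix u assume u: "\<forall>n. u n \<in> Z_space x f N" and "Cauchy u"
    then obtain l where l: "u \<longlonglongrightarrow> l" using Cauchy_bcontfun_LIMSEQ by blast
    have "closed (Z_space x f N)" by (simp add: Z_space_def)
    with u l have "l \<in> Z_space x f N" using closed_sequentially by blast
    with l show "\<exists>l\<in>Z_space x f N. u \<longlonglongrightarrow> l" by blast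
  qed
  show "subspace (Z_space x f N)"
    unfolding Z_space_def range_lin_comb
  proof (rule subspaceI)
    show "0 \<in> closure ?S" using closure_subset span_zero by blast
    fix u v :: "block_index \<Rightarrow>\<^sub>C 'a" and c :: real
    assume u: "u \<in> closure ?S"
    then obtain p where p: "\<And>n. p n \<in> ?S" "p \<longlonglongrightarrow> u" by (auto simp: closure_sequential)
    have "(\<lambda>n. c *\<^sub>R p n) \<longlonglongrightarrow> c *\<^sub>R u" using p(2) by (intro tendsto_intros)
    moreover have "\<And>n. c *\<^sub>R p n \<in> ?S" using p(1) by (simp only: span_scale)
    ultimately show "c *\<^sub>R u \<in> closure ?S"
      unfolding closure_sequential by (intro exI[of _ "\<lambda>n. c *\<^sub>R p n"]) simp
    assume "v \<in> closure ?S"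
    then obtain q where q: "\<And>n. q n \<in> ?S" "q \<longlonglongrightarrow> v" by (auto simp: closure_sequential)
    have "(\<lambda>n. p n + q n) \<longlonglongrightarrow> u + v" using p(2) q(2) by (intro tendsto_intros)
    moreover have "\<And>n. p n + q n \<in> ?S" using p(1) q(1) by (simp only: span_add)
    ultimately show "u + v \<in> closure ?S"
      unfolding closure_sequential by (intro exI[of _ "\<lambda>n. p n + q n"]) simp
  qed
qed

end

theory Submission
  imports Defs
begin

text \<open>
  For fixed \<open>i\<close>, the composition of \<open>f i\<close> with a block projection of the frame is a block of the
  expansion of \<open>f i\<close> along the shrinking frame, and the composition of \<open>f i \<circ> S\<close> with a block
  projection of the basis \<open>w\<close> is a block of the expansion of \<open>f i \<circ> S\<close> in the basis of the dual.
  Both expansions converge in norm, so their late blocks are small. As the second term of the norm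
  of \<open>Z\<close> at level \<open>k\<close> involves only the functionals \<open>f i\<close> with \<open>i \<le> k\<close>, choosing \<open>N k\<close> large
  makes the frame blocks admissible and compensates the weight \<open>2 ^ Suc k\<close>. The first term of the
  norm is controlled by the uniform boundedness principle.
\<close>

text \<open>The closed sets \<open>G n\<close> of points where the whole family is bounded by
  \<open>n\<close> cover the space, so by Baire one of them contains a ball. Subtracting the values
  at its centre turns the bound on the ball into a bound on the operator norms.\<close>

theorem uniform_boundedness_principle:
  fixes T :: "'i \<Rightarrow> 'a::banach \<Rightarrow>\<^sub>L 'b::real_normed_vector"
  assumes "\<And>v. \<exists>C. \<forall>i. norm (T i v) \<le> C"
  obtains C where "\<And>i. norm (T i) \<le> C"
proof -
  define G where "G n = {v. \<forall>i. norm (T i v) \<le> real n}" for n :: nat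
  have closed_G: "closed (G n)" for n
    unfolding G_def by (intro closed_Collect_all closed_Collect_le continuous_intros)
  have "v \<in> (\<Union>n. G n)" for v
  proof -
    obtain C where C: "norm (T i v) \<le> C" for i using assms by blast
    obtain n where "C \<le> real n" using real_arch_simple by blast
    then have "v \<in> G n" unfolding G_def using C order_trans by blast
    then show ?thesis by blast
  qed
  then have "interior (\<Union>(range G)) \<noteq> {}" by (metis UNIV_eq_I UNIV_not_empty interior_UNIV)
  then obtain n where "interior (G n) \<noteq> {}"
    using Baire_category_alt[of "euclidean :: 'a topology" "range G"] closed_G
    by (fastforce simp: completely_metrizable_space_euclidean)
  then obtain v where "v \<in> interior (G n)" by blast
  then obtain e where "0 < e" and e: "cball v e \<subseteq> G n" by (meson mem_interior_cball)
  have "norm (T i) \<le> 2 * real n / e" for i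
  proof (rule norm_blinfun_bound)
    fix u :: 'a
    show "norm (T i u) \<le> 2 * real n / e * norm u"
    proof (cases "u = 0")
      case False
      \<comment> \<open>Scaled to norm \<open>e\<close>, so that \<open>v + ?u\<close> still lies in
        the closed ball around \<open>v\<close>.\<close>
      let ?u = "(e / norm u) *\<^sub>R u"
      have "v \<in> G n" "v + ?u \<in> G n" using e \<open>0 < e\<close> False by (auto simp: subset_iff dist_norm)
      then have "norm (T i v) \<le> real n" "norm (T i (v + ?u)) \<le> real n" by (auto simp: G_def)
      then have "norm (T i (v + ?u) - T i v) \<le> 2 * real n"
        using norm_triangle_ineq4[of "T i (v + ?u)" "T i v"] by linarith
      also have "T i (v + ?u) - T i v = (e / norm u) *\<^sub>R T i u"
        by (simp add: blinfun.add_right blinfun.scaleR_right)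
      finally show ?thesis using \<open>0 < e\<close> False by (simp add: field_simps)
    qed simp
  qed (use \<open>0 < e\<close> in simp)
  then show thesis by (rule that)
qed

lemma sum_block_eq_diff:
  fixes s :: "nat \<Rightarrow> 'a::ab_group_add"
  assumes "m \<le> n"
  shows "(\<Sum>i=m..n. s i) = (\<Sum>i<Suc n. s i) - (\<Sum>i<m. s i)"
  using sum_diff_nat_ivl[of 0 m "Suc n" s] assms
  by (simp only: atLeast0LessThan atLeastLessThanSuc_atLeastAtMost[symmetric] le0 le_SucI)

text \<open>The partial sum operators \<open>R n\<close> converge pointwise, hence are uniformly
  bounded. A block is a difference of two partial sums, which doubles the constant.\<close>

lemma pointwise_sums_imp_blocks_bounded:
  fixes x :: "nat \<Rightarrow> 'b::real_normed_vector" and g :: "nat \<Rightarrow> 'a::banach \<Rightarrow>\<^sub>L real"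
  assumes "\<And>v. summable (\<lambda>i. g i v *\<^sub>R x i)"
  obtains C where "0 \<le> C" "\<And>m n v. norm (\<Sum>i=m..n. g i v *\<^sub>R x i) \<le> C * norm v"
proof -
  define R where "R n = (\<Sum>i<n. blinfun_scaleR_left (x i) o\<^sub>L g i)" for n
  have R: "R n v = (\<Sum>i<n. g i v *\<^sub>R x i)" for n v
    by (simp add: R_def blinfun.sum_left)
  have "\<exists>C. \<forall>n. norm (R n v) \<le> C" for v
  proof -
    have "Bseq (\<lambda>n. R n v)"
      unfolding R using assms summable_iff_convergent convergent_imp_Bseq by blast
    then show ?thesis by (meson Bseq_def)
  qed
  then obtain C where C: "norm (R n) \<le> C" for n using uniform_boundedness_principle by blast
  have "0 \<le> C" using C[of 0] norm_ge_zero order_trans by blast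
  show thesis
  proof (rule that)
    show "0 \<le> 2 * C" using \<open>0 \<le> C\<close> by simp
    fix m n v
    have le: "norm (R l v) \<le> C * norm v" for l
      using norm_blinfun[of "R l" v] C[of l] by (meson mult_right_mono norm_ge_zero order_trans)
    show "norm (\<Sum>i=m..n. g i v *\<^sub>R x i) \<le> 2 * C * norm v"
    proof (cases "m \<le> n")
      case True
      have "(\<Sum>i=m..n. g i v *\<^sub>R x i) = R (Suc n) v - R m v"
        unfolding R using True by (rule sum_block_eq_diff)
      then show ?thesis
        using norm_triangle_ineq4[of "R (Suc n) v" "R m v"] le[of "Suc n"] le[of m] by simp
    qed (use \<open>0 \<le> C\<close> in simp)
  qed
qed

lemma summable_late_blocks_small:
  fixes s :: "nat \<Rightarrow> 'a::banach"
  assumes "summable s" "0 < e"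
  shows "\<forall>\<^sub>F M in sequentially. \<forall>m\<ge>M. \<forall>n. norm (\<Sum>i=m..n. s i) < e"
proof -
  obtain M where M: "norm (sum s {m..<n}) < e" if "M \<le> m" for m n
    using assms summable_Cauchy[of s] by blast
  then have "norm (\<Sum>i=m..n. s i) < e" if "M \<le> m" for m n
    using M[OF that, of "Suc n"] by (simp add: atLeastLessThanSuc_atLeastAtMost)
  then show ?thesis unfolding eventually_sequentially by (meson order_trans)
qed

text \<open>Extending the sum of the norms to all \<open>i \<le> k\<close> makes the bound
  independent of the block.\<close>

lemma norm_frame_proj_le:
  assumes "n0 \<le> k" "\<And>i. i \<le> k \<Longrightarrow> \<bar>blinfun_apply (f i) v\<bar> \<le> b" "0 \<le> b"
  shows "norm (frame_proj x f m0 n0 v) \<le> b * (\<Sum>i\<le>k. norm (x i))"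
proof -
  have "norm (frame_proj x f m0 n0 v) \<le> (\<Sum>i=m0..n0. b * norm (x i))"
    unfolding frame_proj_def
    by (rule sum_norm_le) (use assms in \<open>auto intro: mult_right_mono\<close>)
  also have "\<dots> \<le> (\<Sum>i\<le>k. b * norm (x i))"
    by (rule sum_mono2) (use assms in auto)
  finally show ?thesis by (simp add: sum_distrib_left)
qed

lemma exists_strict_mono_eventually:
  fixes P :: "nat \<Rightarrow> nat \<Rightarrow> bool"
  assumes "\<And>k. eventually (P k) sequentially"
  obtains N where "strict_mono N" "\<And>k. P k (N k)"
proof -
  obtain M where M: "P k n" if "M k \<le> n" for k n
    using assms unfolding eventually_sequentially by metis
  \<comment> \<open>The sum reaches the threshold \<open>M k\<close> and is monotone in
    \<open>k\<close>; the summand \<open>k\<close> makes the growth strict.\<close>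
  define N where "N k = k + (\<Sum>i\<le>k. M i)" for k
  have "strict_mono N" by (simp add: N_def strict_mono_Suc_iff)
  moreover have "P k (N k)" for k
    using member_le_sum[of k "{..k}" M] by (intro M) (simp add: N_def)
  ultimately show thesis by (rule that)
qed

text \<open>Norm convergence in the dual implies pointwise convergence, so evaluating an expansion
  of \<open>\<phi>\<close> at \<open>w j\<close> isolates its \<open>j\<close>-th
  coefficient.\<close>

lemma dual_basis_expansion:
  assumes "\<And>i j. blinfun_apply (g i) (w j) = (if i = j then 1 else 0)" "schauder_basis g"
  shows "(\<lambda>i. blinfun_apply \<phi> (w i) *\<^sub>R g i) sums \<phi>"
proof -
  obtain a where a: "(\<lambda>i. a i *\<^sub>R g i) sums \<phi>"
    using assms(2) unfolding schauder_basis_def by blast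
  have "\<phi> (w j) = a j" for j
  proof -
    have "(\<lambda>i. (a i *\<^sub>R g i) (w j)) sums \<phi> (w j)"
      using bounded_linear.sums[OF blinfun.bounded_linear_left a] .
    moreover have "(\<lambda>i. (a i *\<^sub>R g i) (w j)) = (\<lambda>i. if i = j then a i else 0)"
      by (auto simp: assms(1) blinfun.scaleR_left)
    ultimately show ?thesis using sums_single[of j a] by (metis sums_unique2)
  qed
  then show ?thesis using a by simp
qed

lemma basis_expansion:
  assumes "\<And>i j. blinfun_apply (g i) (w j) = (if i = j then 1 else 0)" "schauder_basis w"
  shows "(\<lambda>i. blinfun_apply (g i) u *\<^sub>R w i) sums u"
proof -
  obtain a where a: "(\<lambda>i. a i *\<^sub>R w i) sums u"
    using assms(2) unfolding schauder_basis_def by blast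
  have "g j u = a j" for j
  proof -
    have "(\<lambda>i. g j (a i *\<^sub>R w i)) sums g j u"
      using bounded_linear.sums[OF blinfun.bounded_linear_right a] .
    moreover have "(\<lambda>i. g j (a i *\<^sub>R w i)) = (\<lambda>i. if i = j then a i else 0)"
      by (auto simp: assms(1) blinfun.scaleR_right)
    ultimately show ?thesis using sums_single[of j a] by (metis sums_unique2)
  qed
  then show ?thesis using a by simp
qed

lemma apply_lin_comb_biorthogonal:
  assumes "\<And>i j. blinfun_apply (g i) (w j) = (if i = j then 1 else 0)" "a \<in> c00"
  shows "blinfun_apply (g i) (lin_comb a w) = a i"
proof -
  have "finite {j. a j \<noteq> 0}" using assms(2) by (simp add: c00_def)
  then show ?thesis
    by (simp add: lin_comb_def blinfun.sum_right blinfun.scaleR_right assms(1) sum.delta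
        if_distrib[of "\<lambda>c. _ * c"] cong: if_cong)
qed

lemma sums_at_basis_vector:
  fixes z :: "nat \<Rightarrow> 'a::real_normed_vector"
  shows "(\<lambda>i. (if i = j then 1 else 0) *\<^sub>R z i) sums z j"
proof -
  have "(\<lambda>i. (if i = j then 1 else 0) *\<^sub>R z i) = (\<lambda>i. if i = j then z i else 0)" by auto
  then show ?thesis using sums_single[of j z] by simp
qed

text \<open>Transposition: \<open>\<phi>\<close> composed with the block operator is the block of
  the series of the \<open>g j\<close> with coefficients \<open>\<phi> (y j)\<close>. Smallness in
  the dual thus becomes an estimate uniform in \<open>v\<close>.\<close>

lemma abs_apply_block_le:
  fixes g :: "nat \<Rightarrow> 'a::real_normed_vector \<Rightarrow>\<^sub>L real" and \<phi> :: "'b::real_normed_vector \<Rightarrow>\<^sub>L real"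
  assumes "norm (\<Sum>j=m..n. blinfun_apply \<phi> (y j) *\<^sub>R g j) \<le> e"
  shows "\<bar>blinfun_apply \<phi> (\<Sum>j=m..n. blinfun_apply (g j) v *\<^sub>R y j)\<bar> \<le> e * norm v"
proof -
  have "blinfun_apply \<phi> (\<Sum>j=m..n. g j v *\<^sub>R y j) = (\<Sum>j=m..n. blinfun_apply \<phi> (y j) *\<^sub>R g j) v"
    by (simp add: blinfun.sum_left blinfun.sum_right blinfun.scaleR_left blinfun.scaleR_right
        mult.commute)
  also have "\<bar>\<dots>\<bar> \<le> norm (\<Sum>j=m..n. blinfun_apply \<phi> (y j) *\<^sub>R g j) * norm v"
    using norm_blinfun[of "\<Sum>j=m..n. blinfun_apply \<phi> (y j) *\<^sub>R g j" v] by simp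
  finally show ?thesis using assms by (meson mult_right_mono norm_ge_zero order_trans)
qed

theorem theorem4p1:
  fixes x :: "nat \<Rightarrow> 'a::banach"
    and f :: "nat \<Rightarrow> 'a \<Rightarrow>\<^sub>L real"
    and w :: "nat \<Rightarrow> 'w::banach"
  assumes "\<exists>D :: 'a set. countable D \<and> closure D = UNIV"
    and "\<nexists>B :: 'a set. finite B \<and> span B = UNIV"
    and "shrinking_frame x f"
    and "associated_basis x f w"
    and "shrinking_basis w"
  shows "\<exists>N. admissible x f N \<and> dominates w (Z_basis x f N)"
proof -
  obtain g :: "nat \<Rightarrow> 'w \<Rightarrow>\<^sub>L real" where biorth: "blinfun_apply (g i) (w j) = (if i = j then 1 else 0)"
    and w: "schauder_basis w" and g: "schauder_basis g" for i j
    using assms(5) unfolding shrinking_basis_def by (elim conjE exE) metis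
  obtain S :: "'w \<Rightarrow>\<^sub>L 'a" where
    S: "(\<lambda>i. a i *\<^sub>R w i) sums u \<Longrightarrow> (\<lambda>i. a i *\<^sub>R x i) sums S u" for a u
    using assms(4) unfolding associated_basis_def by blast
  have S_w: "S (w j) = x j" for j
    using S[OF sums_at_basis_vector] sums_at_basis_vector by (rule sums_unique2)
  \<comment> \<open>\<open>S\<close> carries the expansion of \<open>u\<close> in \<open>w\<close>
    to this series. Uniform boundedness of its blocks then gives the constant \<open>C\<close> for
    the first supremum in the norm of \<open>Z\<close>.\<close>
  have gx: "summable (\<lambda>i. g i u *\<^sub>R x i)" for u
    using S[OF basis_expansion[OF biorth w]] by (rule sums_summable)
  obtain C where C: "0 \<le> C" "norm (\<Sum>i=m..n. g i u *\<^sub>R x i) \<le> C * norm u" for m n u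
    by (rule pointwise_sums_imp_blocks_bounded[OF gx]) (rule that)
  have f_expansion: "summable (\<lambda>j. f i (x j) *\<^sub>R f j)" for i
    using assms(3) unfolding shrinking_frame_def by (meson sums_summable)
  \<comment> \<open>Since \<open>S (w j) = x j\<close>, the coefficients of
    \<open>f i o\<^sub>L S\<close> along \<open>g\<close> are those of \<open>f i\<close> along the
    frame.\<close>
  have fS_expansion: "summable (\<lambda>j. f i (x j) *\<^sub>R g j)" for i
    using sums_summable[OF dual_basis_expansion[OF biorth g, of "f i o\<^sub>L S"]] by (simp add: S_w)
  define c where "c k = (\<Sum>i\<le>k. norm (x i)) + 1" for k
  \<comment> \<open>Dividing by \<open>c k\<close> absorbs the factor from
    \<open>norm_frame_proj_le\<close>; the added 1 in \<open>c k\<close> keeps the divisor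
    positive.\<close>
  define \<epsilon> where "\<epsilon> k = (1/2) ^ Suc k / c k" for k
  have c: "0 < c k" for k by (simp add: c_def sum_nonneg add_nonneg_pos)
  then have \<epsilon>: "0 < \<epsilon> k" for k by (simp add: \<epsilon>_def)
  let ?small = "\<lambda>h k M. \<forall>i\<in>{..k}. \<forall>m\<ge>M. \<forall>n. norm (\<Sum>j=m..n. f i (x j) *\<^sub>R h j) < \<epsilon> k"
  \<comment> \<open>Only finitely many \<open>i \<le> k\<close> are involved, so one threshold
    serves them all and both expansions.\<close>
  have ev: "\<forall>\<^sub>F M in sequentially. ?small f k M \<and> ?small g k M" for k
    by (intro eventually_conj eventually_ball_finite ballI finite_atMost
        summable_late_blocks_small f_expansion fS_expansion \<epsilon>)
  obtain N where N: "strict_mono N" and small: "?small f k (N k) \<and> ?small g k (N k)" for k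
    by (rule exists_strict_mono_eventually[of "\<lambda>k M. ?small f k M \<and> ?small g k M", OF ev]) (rule that)
  have proj_le: "norm (frame_proj x f m0 n0 y) \<le> (1/2) ^ Suc k * b"
    if "n0 \<le> k" "\<And>i. i \<le> k \<Longrightarrow> \<bar>f i y\<bar> \<le> \<epsilon> k * b" "0 \<le> b" for m0 n0 k y b
  proof -
    have "norm (frame_proj x f m0 n0 y) \<le> \<epsilon> k * b * (\<Sum>i\<le>k. norm (x i))"
      using that \<epsilon>[of k] by (intro norm_frame_proj_le) auto
    also have "\<dots> \<le> \<epsilon> k * b * c k"
      using that(3) \<epsilon>[of k] by (intro mult_left_mono) (auto simp: c_def)
    also have "\<dots> = (1/2) ^ Suc k * b" using c[of k] by (simp add: \<epsilon>_def)
    finally show ?thesis .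
  qed
  have "admissible x f N"
    unfolding admissible_def
  proof (intro conjI N allI SUP_least; clarify)
    fix k v m0 n0 m n
    assume *: "m0 < n0" "n0 \<le> k" "N k \<le> m" "m \<le> n"
    have "\<bar>f i (frame_proj x f m n v)\<bar> \<le> \<epsilon> k * norm v" if "i \<le> k" for i
      unfolding frame_proj_def using small[of k] that * by (intro abs_apply_block_le less_imp_le) auto
    then show "ennreal (norm (frame_proj x f m0 n0 (frame_proj x f m n v)))
        \<le> ennreal ((1/2) ^ Suc k * norm v)"
      using * by (intro ennreal_leI proj_le) auto
  qed
  \<comment> \<open>The first supremum is at most \<open>C\<close> and the second at most 1 times
    the norm of the combination in \<open>w\<close>; \<open>C + 1\<close> covers both and is
    positive.\<close>
  moreover have "norm (lin_comb a (Z_basis x f N)) \<le> (C + 1) * norm (lin_comb a w)"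
    if a: "a \<in> c00" for a
  proof -
    define u where "u = lin_comb a w"
    have coord: "a i = g i u" for i using apply_lin_comb_biorthogonal[OF biorth a] by (simp add: u_def)
    have "Z_norm x f N a \<le> ennreal ((C + 1) * norm u)"
      unfolding Z_norm_def
    proof (intro max.boundedI SUP_least; clarify)
      fix m n :: nat
      have "norm (\<Sum>i=m..n. a i *\<^sub>R x i) \<le> C * norm u" unfolding coord by (rule C)
      also have "\<dots> \<le> (C + 1) * norm u" by (simp add: mult_right_mono)
      finally show "ennreal (norm (\<Sum>i=m..n. a i *\<^sub>R x i)) \<le> ennreal ((C + 1) * norm u)"
        by (rule ennreal_leI)
    next
      fix k m0 n0 m n :: nat
      assume *: "m0 \<le> n0" "n0 \<le> k" "N k \<le> m" "m \<le> n"
      \<comment> \<open>With \<open>a j = g j u\<close>, the block is \<open>S\<close> applied to a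
        block of \<open>u\<close> in \<open>w\<close>, so the smallness along \<open>g\<close>
        applies.\<close>
      have "\<bar>f i (\<Sum>i=m..n. a i *\<^sub>R x i)\<bar> \<le> \<epsilon> k * norm u" if "i \<le> k" for i
        unfolding coord using small[of k] that * by (intro abs_apply_block_le less_imp_le) auto
      then have "norm (frame_proj x f m0 n0 (\<Sum>i=m..n. a i *\<^sub>R x i)) \<le> (1/2) ^ Suc k * norm u"
        using * by (intro proj_le) auto
      then have "2 ^ Suc k * norm (frame_proj x f m0 n0 (\<Sum>i=m..n. a i *\<^sub>R x i)) \<le> norm u"
        by (simp add: field_simps power_one_over)
      also have "\<dots> \<le> (C + 1) * norm u" using C(1) by (simp add: mult_le_cancel_right1)
      finally show "ennreal (2 ^ Suc k * norm (frame_proj x f m0 n0 (\<Sum>i=m..n. a i *\<^sub>R x i)))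
          \<le> ennreal ((C + 1) * norm u)"
        by (rule ennreal_leI)
    qed
    then show ?thesis
      using C(1) by (simp add: norm_lin_comb_Z_basis[OF N a, symmetric] u_def)
  qed
  then have "dominates w (Z_basis x f N)"
    unfolding dominates_def using C(1) by (intro exI[of _ "C + 1"]) auto
  ultimately show ?thesis by blast
qed

end
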